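(* Let $\kappa$ be a regular infinite cardinal. If $\mathfrak{r}_\kappa<\mathfrak{d}_\kappa$ then $\mathfrak{r}_\kappa=\mathfrak{u}_\kappa$. Consequently, $\mathfrak{r}_\kappa<\mathfrak{d}_\kappa$ implies $\operatorname{cf}(\mathfrak{r}_\kappa)>\omega$.
   Context: A set $S\in[\kappa]^\kappa$ splits $B\in[\kappa]^\kappa$ if $|S\cap B|=|B\setminus S|=\kappa$. The reaping number $\mathfrak{r}_\kappa$ is the minimal cardinality of a family $\mathcal{A}\subseteq[\kappa]^\kappa$ such that no single $S\in[\kappa]^\kappa$ splits every member of $\mathcal{A}$. An ultrafilter over $\kappa$ is uniform if all its elements have size $\kappa$; a base of an ultrafilter $\mathscr{U}$ is $\mathcal{B}\subseteq\mathscr{U}$ such that every element of $\mathscr{U}$ contains an element of $\mathcal{B}$; $\mathfrak{u}_\kappa$ is the minimal cardinality of a base of a uniform ultrafilter over $\kappa$. For $f,g\in{}^\kappa\kappa$, $f\le^* g$ means $|\{\beta<\kappa:f(\beta)>g(\beta)\}|<\kappa$; $\mathfrak{d}_\kappa$ is the minimal cardinality of a family $\mathcal{D}\subseteq{}^\kappa\kappa$ such that every $f\in{}^\kappa\kappa$ satisfies $f\le^* g$ for some $g\in\mathcal{D}$. *)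

theory Defs
  imports Main "HOL-Library.FuncSet"
begin

unbundle cardinal_syntax

text \<open>The regular infinite cardinal kappa is represented by a cardinal-order relation
  r (a well-order which is initial, i.e. a von Neumann cardinal), with Field r playing
  the role of the set of ordinals below kappa, ordered by r.\<close>

definition kappa_subsets :: "'a rel \<Rightarrow> 'a set set" where
  "kappa_subsets r = {A. A \<subseteq> Field r \<and> card_of A =o r}"

definition splits :: "'a rel \<Rightarrow> 'a set \<Rightarrow> 'a set \<Rightarrow> bool" where
  "splits r S B \<longleftrightarrow> card_of (S \<inter> B) =o r \<and> card_of (B - S) =o r"

definition unsplit_family :: "'a rel \<Rightarrow> 'a set set \<Rightarrow> bool" where
  "unsplit_family r \<A> \<longleftrightarrow> \<A> \<subseteq> kappa_subsets r \<and>
     \<not> (\<exists>S \<in> kappa_subsets r. \<forall>B \<in> \<A>. splits r S B)"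

definition uniform_ultrafilter :: "'a rel \<Rightarrow> 'a set set \<Rightarrow> bool" where
  "uniform_ultrafilter r U \<longleftrightarrow>
     U \<subseteq> Pow (Field r) \<and> Field r \<in> U \<and> {} \<notin> U \<and>
     (\<forall>X \<in> U. \<forall>Y. X \<subseteq> Y \<and> Y \<subseteq> Field r \<longrightarrow> Y \<in> U) \<and>
     (\<forall>X \<in> U. \<forall>Y \<in> U. X \<inter> Y \<in> U) \<and>
     (\<forall>X. X \<subseteq> Field r \<longrightarrow> X \<in> U \<or> Field r - X \<in> U) \<and>
     (\<forall>X \<in> U. card_of X =o r)"

definition is_base :: "'a set set \<Rightarrow> 'a set set \<Rightarrow> bool" where
  "is_base U \<B> \<longleftrightarrow> \<B> \<subseteq> U \<and> (\<forall>X \<in> U. \<exists>Y \<in> \<B>. Y \<subseteq> X)"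

definition uniform_ultrafilter_base :: "'a rel \<Rightarrow> 'a set set \<Rightarrow> bool" where
  "uniform_ultrafilter_base r \<B> \<longleftrightarrow> (\<exists>U. uniform_ultrafilter r U \<and> is_base U \<B>)"

definition kappa_funs :: "'a rel \<Rightarrow> ('a \<Rightarrow> 'a) set" where
  "kappa_funs r = (Field r \<rightarrow>\<^sub>E Field r)"

definition le_star :: "'a rel \<Rightarrow> ('a \<Rightarrow> 'a) \<Rightarrow> ('a \<Rightarrow> 'a) \<Rightarrow> bool" where
  "le_star r f g \<longleftrightarrow>
     card_of {\<beta> \<in> Field r. (g \<beta>, f \<beta>) \<in> r \<and> g \<beta> \<noteq> f \<beta>} <o r"

definition dominating_family :: "'a rel \<Rightarrow> ('a \<Rightarrow> 'a) set \<Rightarrow> bool" where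
  "dominating_family r \<D> \<longleftrightarrow> \<D> \<subseteq> kappa_funs r \<and>
     (\<forall>f \<in> kappa_funs r. \<exists>g \<in> \<D>. le_star r f g)"

definition mincard :: "('b set \<Rightarrow> bool) \<Rightarrow> 'b rel" where
  "mincard P = card_of (SOME A. P A \<and> (\<forall>B. P B \<longrightarrow> card_of A \<le>o card_of B))"

definition reaping_number :: "'a rel \<Rightarrow> 'a set rel" where
  "reaping_number r = mincard (unsplit_family r)"

definition ultrafilter_number :: "'a rel \<Rightarrow> 'a set rel" where
  "ultrafilter_number r = mincard (uniform_ultrafilter_base r)"

definition dominating_number :: "'a rel \<Rightarrow> ('a \<Rightarrow> 'a) rel" where
  "dominating_number r = mincard (dominating_family r)"

end

theory Submission
  imports Defs
begin

text \<open>Close an unsplit family of size \<open>\<rr>\<close> under taking copies of itself inside its members; the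
  resulting family \<open>\<F>\<close> is then a pi-base of a uniform ultrafilter \<open>U\<close>. Since \<open>|\<F> \<times> \<F>| < \<dd>\<close>,
  there is an \<open>f\<close> such that any two members of \<open>\<F>\<close> meet a common interval \<open>[n, f n]\<close>. Cut \<open>\<kappa>\<close> into
  consecutive blocks so long that each \<open>[n, f n]\<close> touches at most two of them, and colour
  the blocks alternately; one colour class lies in \<open>U\<close>. Two members of \<open>\<F>\<close> inside this class
  always meet a common block, so their images under the map \<open>\<rho>\<close> sending a point to its block
  generate the ultrafilter \<open>\<rho>(U)\<close>, and hence \<open>\<uu> \<le> \<rr>\<close>.

  If \<open>\<rr> = \<uu>\<close> had countable cofinality, a base would be an increasing union of families \<open>\<B>\<^sub>n\<close>, each
  too small to be unsplit. Take \<open>S\<^sub>n \<in> U\<close> splitting \<open>\<B>\<^sub>n\<close>. No set in \<open>U\<close> is almost contained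
  in every \<open>S\<^sub>n\<close>, so each member of the base meets infinitely many of the differences \<open>P\<^sub>n\<close> of the
  partial intersections in \<open>\<kappa>\<close> many points. Splitting the traces of \<open>\<B>\<^sub>n\<close> on \<open>P\<^sub>n\<close>, separately for
  each \<open>n\<close>, gives one set that splits the whole base, which is absurd.\<close>

section \<open>Attained minima and ultrafilters from partition regular properties\<close>

text \<open>Cardinals are well-ordered, so the \<open>SOME\<close> in \<open>mincard\<close> names a
  true minimum as soon as one set satisfies \<open>P\<close>. Without such a witness the value of
  \<open>mincard\<close> is arbitrary.\<close>

lemma mincard_attained:
  assumes "P A"
  obtains M where "P M" "mincard P = |M|" "\<And>B. P B \<Longrightarrow> |M| \<le>o |B|"
proof -
  have "\<exists>q \<in> card_of ` {A. P A}. \<forall>q' \<in> card_of ` {A. P A}. q \<le>o q'"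
    using assms by (intro exists_minim_Card_order) (auto simp: card_of_Card_order)
  then have "\<exists>M. P M \<and> (\<forall>B. P B \<longrightarrow> |M| \<le>o |B| )"
    by auto
  from someI_ex[OF this] show ?thesis
    using that unfolding mincard_def by blast
qed

lemma mincard_le: "P A \<Longrightarrow> mincard P \<le>o |A|"
  by (metis mincard_attained)

text \<open>Zorn's lemma yields a maximal filter among those whose members all satisfy
  \<open>P\<close>. If it omitted both \<open>A\<close> and \<open>X - A\<close>, it would have
  members \<open>B\<close> and \<open>C\<close> such that \<open>B \<inter> A\<close> and
  \<open>C \<inter> (X - A)\<close> fail \<open>P\<close>. But \<open>B \<inter> C\<close> satisfies
  \<open>P\<close> and is the union of a subset of each, against partition regularity.\<close>

lemma ultrafilter_of_partition_regular:
  fixes P :: "'a set \<Rightarrow> bool"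
  assumes top: "P X"
    and mono: "\<And>A B. P A \<Longrightarrow> A \<subseteq> B \<Longrightarrow> B \<subseteq> X \<Longrightarrow> P B"
    and part: "\<And>A B. A \<subseteq> X \<Longrightarrow> B \<subseteq> X \<Longrightarrow> P (A \<union> B) \<Longrightarrow> P A \<or> P B"
  shows "\<exists>U. U \<subseteq> Pow X \<and> X \<in> U \<and> (\<forall>A\<in>U. P A)
    \<and> (\<forall>A\<in>U. \<forall>B. A \<subseteq> B \<and> B \<subseteq> X \<longrightarrow> B \<in> U) \<and> (\<forall>A\<in>U. \<forall>B\<in>U. A \<inter> B \<in> U)
    \<and> (\<forall>A. A \<subseteq> X \<longrightarrow> A \<in> U \<or> X - A \<in> U)"
proof -
  define \<C> where "\<C> = {F. F \<subseteq> Pow X \<and> X \<in> F \<and> (\<forall>A\<in>F. P A)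
    \<and> (\<forall>A\<in>F. \<forall>B. A \<subseteq> B \<and> B \<subseteq> X \<longrightarrow> B \<in> F) \<and> (\<forall>A\<in>F. \<forall>B\<in>F. A \<inter> B \<in> F)}"
  have "{X} \<in> \<C>" using top by (auto simp: \<C>_def)
  moreover have "\<Union>\<F> \<in> \<C>" if "\<F> \<noteq> {}" "subset.chain \<C> \<F>" for \<F>
  proof -
    have sub: "\<F> \<subseteq> \<C>" and lin: "\<And>F G. F \<in> \<F> \<Longrightarrow> G \<in> \<F> \<Longrightarrow> F \<subseteq> G \<or> G \<subseteq> F"
      using that by (auto simp: subset_chain_def)
    have inter: "A \<inter> B \<in> \<Union>\<F>" if "A \<in> \<Union>\<F>" "B \<in> \<Union>\<F>" for A B
    proof -
      from that obtain F G where FG: "F \<in> \<F>" "G \<in> \<F>" "A \<in> F" "B \<in> G" by blast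
      with lin[of F G] have "\<exists>H\<in>\<F>. A \<in> H \<and> B \<in> H" by blast
      with sub show ?thesis unfolding \<C>_def by blast
    qed
    have mem: "F \<subseteq> Pow X" "X \<in> F" "\<forall>A\<in>F. P A"
      "\<forall>A\<in>F. \<forall>B. A \<subseteq> B \<and> B \<subseteq> X \<longrightarrow> B \<in> F" if "F \<in> \<F>" for F
      using subsetD[OF sub that] unfolding \<C>_def by simp_all
    have "\<Union>\<F> \<subseteq> Pow X" using mem(1) by blast
    moreover have "X \<in> \<Union>\<F>" using mem(2) \<open>\<F> \<noteq> {}\<close> by blast
    moreover have "\<forall>A\<in>\<Union>\<F>. P A" using mem(3) by blast
    moreover have "\<forall>A\<in>\<Union>\<F>. \<forall>B. A \<subseteq> B \<and> B \<subseteq> X \<longrightarrow> B \<in> \<Union>\<F>"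
      using mem(4) by (meson UnionE UnionI)
    moreover have "\<forall>A\<in>\<Union>\<F>. \<forall>B\<in>\<Union>\<F>. A \<inter> B \<in> \<Union>\<F>" using inter by blast
    ultimately show ?thesis unfolding \<C>_def by (intro CollectI conjI)
  qed
  ultimately obtain U where U: "U \<in> \<C>" and max: "\<And>F. F \<in> \<C> \<Longrightarrow> U \<subseteq> F \<Longrightarrow> F = U"
    using subset_Zorn_nonempty[of \<C>] by blast
  note U_conj = U[unfolded \<C>_def, THEN CollectD]
  have U': "U \<subseteq> Pow X" "X \<in> U" "\<And>A. A \<in> U \<Longrightarrow> P A"
    using U_conj by simp_all
  have int: "\<And>A B. A \<in> U \<Longrightarrow> B \<in> U \<Longrightarrow> A \<inter> B \<in> U" using U_conj by simp
  have ext: "Z \<in> U" if "Z \<subseteq> X" and pos: "\<And>A. A \<in> U \<Longrightarrow> P (A \<inter> Z)" for Z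
  proof -
    \<comment> \<open>The filter generated by \<open>U\<close> and \<open>Z\<close>. By
      \<open>pos\<close> its members satisfy \<open>P\<close>, so maximality makes it equal to
      \<open>U\<close>.\<close>
    define F where "F = {Y. Y \<subseteq> X \<and> (\<exists>A\<in>U. A \<inter> Z \<subseteq> Y)}"
    have "A \<inter> B \<in> F" if "A \<in> F" "B \<in> F" for A B
    proof -
      from that obtain A' B' where "A' \<in> U" "B' \<in> U" "A' \<inter> Z \<subseteq> A" "B' \<inter> Z \<subseteq> B" "A \<subseteq> X"
        unfolding F_def by blast
      moreover from this have "A' \<inter> B' \<in> U" "(A' \<inter> B') \<inter> Z \<subseteq> A \<inter> B"
        using int by blast+
      ultimately show ?thesis unfolding F_def by blast
    qed
    moreover have "\<forall>A\<in>F. P A" using mono pos by (auto simp: F_def)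
    moreover have "F \<subseteq> Pow X" "X \<in> F" "\<forall>A\<in>F. \<forall>B. A \<subseteq> B \<and> B \<subseteq> X \<longrightarrow> B \<in> F"
      using U'(2) by (auto simp: F_def)
    ultimately have "F \<in> \<C>" unfolding \<C>_def by blast
    moreover have "U \<subseteq> F" using U'(1) by (auto simp: F_def)
    ultimately have "F = U" by (rule max)
    moreover have "Z \<in> F" using \<open>Z \<subseteq> X\<close> U'(2) by (auto simp: F_def)
    ultimately show ?thesis by simp
  qed
  have "A \<in> U \<or> X - A \<in> U" if "A \<subseteq> X" for A
  proof (rule ccontr)
    assume no: "\<not> ?thesis"
    with ext[of A] that obtain B where B: "B \<in> U" "\<not> P (B \<inter> A)" by blast
    from no ext[of "X - A"] obtain C where C: "C \<in> U" "\<not> P (C \<inter> (X - A))" by blast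
    have BC: "B \<inter> C \<in> U" "B \<subseteq> X" "C \<subseteq> X" using B C int U'(1) by blast+
    have "B \<inter> C = (B \<inter> C \<inter> A) \<union> (B \<inter> C \<inter> (X - A))" using BC by blast
    with U'(3)[OF BC(1)] part[of "B \<inter> C \<inter> A" "B \<inter> C \<inter> (X - A)"] BC
    have "P (B \<inter> C \<inter> A) \<or> P (B \<inter> C \<inter> (X - A))" by auto
    with mono[of "B \<inter> C \<inter> A" "B \<inter> A"] mono[of "B \<inter> C \<inter> (X - A)" "C \<inter> (X - A)"] B C BC
    show False by blast
  qed
  with U_conj show ?thesis by (intro exI[of _ U]) simp
qed

section \<open>Order and smallness on a regular cardinal\<close>

locale regular_cardinal =
  fixes r :: "'a rel"
  assumes Card: "Card_order r" and inf: "infinite (Field r)" and reg: "regularCard r"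
begin

abbreviation \<kappa> :: "'a set" where "\<kappa> \<equiv> Field r"

abbreviation le (infix "\<preceq>" 50) where "x \<preceq> y \<equiv> (x, y) \<in> r"

definition lt (infix "\<prec>" 50) where "x \<prec> y \<longleftrightarrow> x \<preceq> y \<and> x \<noteq> y"

lemma Well: "Well_order r"
  using Card by (simp add: card_order_on_well_order_on)

lemma fields: "x \<preceq> y \<Longrightarrow> x \<in> \<kappa>" "x \<preceq> y \<Longrightarrow> y \<in> \<kappa>"
  by (auto simp: Field_def)

lemma lt_fields: "x \<prec> y \<Longrightarrow> x \<in> \<kappa>" "x \<prec> y \<Longrightarrow> y \<in> \<kappa>"
  by (auto simp: Field_def lt_def)

lemma le_refl: "x \<in> \<kappa> \<Longrightarrow> x \<preceq> x"
  using Well by (auto simp: order_on_defs refl_on_def)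

lemma le_trans: "x \<preceq> y \<Longrightarrow> y \<preceq> z \<Longrightarrow> x \<preceq> z"
  using Well by (auto simp: order_on_defs elim: transE)

lemma le_antisym: "x \<preceq> y \<Longrightarrow> y \<preceq> x \<Longrightarrow> x = y"
  using Well by (auto simp: order_on_defs elim: antisymD)

lemma not_le: "x \<in> \<kappa> \<Longrightarrow> y \<in> \<kappa> \<Longrightarrow> \<not> x \<preceq> y \<longleftrightarrow> y \<prec> x"
  using Well le_antisym le_refl unfolding order_on_defs total_on_def lt_def by metis

lemma not_lt: "x \<in> \<kappa> \<Longrightarrow> y \<in> \<kappa> \<Longrightarrow> \<not> x \<prec> y \<longleftrightarrow> y \<preceq> x"
  using not_le by blast

lemma lt_imp_le: "x \<prec> y \<Longrightarrow> x \<preceq> y"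
  by (simp add: lt_def)

lemma le_lt_trans: "x \<preceq> y \<Longrightarrow> y \<prec> z \<Longrightarrow> x \<prec> z"
  using le_trans le_antisym unfolding lt_def by blast

lemma lt_le_trans: "x \<prec> y \<Longrightarrow> y \<preceq> z \<Longrightarrow> x \<prec> z"
  using le_trans le_antisym unfolding lt_def by blast

lemma lt_irrefl: "\<not> x \<prec> x"
  by (simp add: lt_def)

lemma wf_lt: "wf {(x, y). x \<prec> y}"
proof -
  have "{(x, y). x \<prec> y} = r - Id" by (auto simp: lt_def)
  then show ?thesis using Well by (simp add: well_order_on_def)
qed

lemma least:
  assumes "x \<in> \<kappa>" "P x"
  obtains m where "m \<in> \<kappa>" "P m" "\<And>y. y \<in> \<kappa> \<Longrightarrow> P y \<Longrightarrow> m \<preceq> y"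
proof -
  obtain m where m: "m \<in> {x \<in> \<kappa>. P x}" "\<And>y. y \<prec> m \<Longrightarrow> y \<notin> {x \<in> \<kappa>. P x}"
    using wfE_min[OF wf_lt, of x "{x \<in> \<kappa>. P x}"] assms by auto
  then show ?thesis using that[of m] not_lt by blast
qed

lemma no_max: "a \<in> \<kappa> \<Longrightarrow> \<exists>b. a \<prec> b"
  using infinite_Card_order_limit[OF Card inf] by (auto simp: lt_def)

lemma small_Un: "|A| <o r \<Longrightarrow> |B| <o r \<Longrightarrow> |A \<union> B| <o r"
  using card_of_Un_ordLess_infinite_Field[OF inf Card] by blast

lemma small_mono: "|B| <o r \<Longrightarrow> A \<subseteq> B \<Longrightarrow> |A| <o r"
  using card_of_mono1 ordLeq_ordLess_trans by blast

lemma small_image: "|A| <o r \<Longrightarrow> |f ` A| <o r"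
  using card_of_image ordLeq_ordLess_trans by blast

lemma small_UN: "|I| <o r \<Longrightarrow> (\<And>i. i \<in> I \<Longrightarrow> |A i| <o r) \<Longrightarrow> |\<Union>i\<in>I. A i| <o r"
  using card_of_UNION_ordLess_infinite_Field_regularCard[OF reg, of I A] inf Card
  by (simp add: cinfinite_def)

lemma small_finite: "finite A \<Longrightarrow> |A| <o r"
  using finite_ordLess_infinite[OF card_of_Well_order Well] inf by (simp add: Field_card_of)

text \<open>Regularity enters here and in \<open>small_UN\<close>: a set of size below \<kappa> is
  not cofinal, and since there is no largest element the bound can be made strict.\<close>

lemma small_bounded:
  assumes "X \<subseteq> \<kappa>" "|X| <o r"
  obtains b where "b \<in> \<kappa>" "\<And>x. x \<in> X \<Longrightarrow> x \<prec> b"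
proof -
  have "\<not> cofinal X r"
    using assms reg not_ordLess_ordIso unfolding regularCard_def by blast
  then obtain a where a: "a \<in> \<kappa>" "\<forall>b\<in>X. a = b \<or> \<not> a \<preceq> b"
    unfolding cofinal_def by blast
  obtain b where b: "a \<prec> b" using no_max a(1) by blast
  have "x \<prec> b" if "x \<in> X" for x
    using that a assms b by (metis le_lt_trans lt_imp_le not_le subsetD)
  with b lt_fields show ?thesis using that by blast
qed

lemma bounded_small: "b \<in> \<kappa> \<Longrightarrow> (\<And>x. x \<in> X \<Longrightarrow> x \<prec> b) \<Longrightarrow> |X| <o r"
  using small_mono[OF card_of_underS[OF Card], of b X] by (auto simp: underS_def lt_def)

lemma small_underS: "b \<in> \<kappa> \<Longrightarrow> |{x. x \<prec> b}| <o r"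
  by (rule bounded_small) auto

lemma small_under: "b \<in> \<kappa> \<Longrightarrow> |{x. x \<preceq> b}| <o r"
  using small_mono[OF small_Un[OF small_underS small_finite], of b "{b}" "{x. x \<preceq> b}"]
  by (auto simp: lt_def)

lemma not_small: "X \<subseteq> \<kappa> \<Longrightarrow> \<not> |X| <o r \<longleftrightarrow> |X| =o r"
  using card_of_mono1[of X \<kappa>] card_of_Field_ordIso[OF Card] not_ordLess_ordIso
    ordLeq_iff_ordLess_or_ordIso ordLeq_ordIso_trans by blast

lemma unbounded_large:
  assumes "X \<subseteq> \<kappa>" "\<And>b. b \<in> \<kappa> \<Longrightarrow> \<exists>x\<in>X. b \<preceq> x"
  shows "|X| =o r"
  using assms small_bounded not_small le_lt_trans lt_irrefl by metis

lemma large_unbounded: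
  assumes "X \<subseteq> \<kappa>" "|X| =o r" "b \<in> \<kappa>"
  obtains x where "x \<in> X" "b \<preceq> x"
  using assms bounded_small[of b X] not_small not_lt by blast

lemma kappa_large: "\<kappa> \<in> kappa_subsets r"
  using card_of_Field_ordIso[OF Card] by (simp add: kappa_subsets_def)

lemma kappa_subsetsI: "X \<subseteq> \<kappa> \<Longrightarrow> \<not> |X| <o r \<Longrightarrow> X \<in> kappa_subsets r"
  using not_small by (simp add: kappa_subsets_def)

lemma kappa_subsetsD:
  assumes "X \<in> kappa_subsets r"
  shows "X \<subseteq> \<kappa>" "|X| =o r" "\<not> |X| <o r"
  using assms not_small by (auto simp: kappa_subsets_def)

lemma large_diff_small:
  assumes "X \<in> kappa_subsets r" "|Y| <o r"
  shows "X - Y \<in> kappa_subsets r"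
proof (rule kappa_subsetsI)
  show "X - Y \<subseteq> \<kappa>" using kappa_subsetsD(1)[OF assms(1)] by blast
  show "\<not> |X - Y| <o r"
    using small_mono[OF small_Un[OF _ assms(2), of "X - Y"], of X] kappa_subsetsD(3)[OF assms(1)]
    by blast
qed

section \<open>Fast sequences and coloured blocks\<close>

text \<open>The successor relation of the well-order. As a relation it needs no default value:
  limits and the least element simply cover nothing.\<close>

definition covers where
  "covers \<eta> \<xi> \<longleftrightarrow> \<xi> \<prec> \<eta> \<and> (\<forall>\<zeta>. \<xi> \<prec> \<zeta> \<longrightarrow> \<eta> \<preceq> \<zeta>)"

lemma covers_exists:
  assumes "\<xi> \<in> \<kappa>"
  obtains \<eta> where "covers \<eta> \<xi>"
  using no_max[OF assms] least[of _ "\<lambda>z. \<xi> \<prec> z"] lt_fields unfolding covers_def by metis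

lemma covers_unique: "covers \<eta> \<xi> \<Longrightarrow> covers \<eta>' \<xi> \<Longrightarrow> \<eta> = \<eta>'"
  unfolding covers_def by (simp add: le_antisym)

lemma covers_inj: "covers \<eta> \<xi> \<Longrightarrow> covers \<eta> \<xi>' \<Longrightarrow> \<xi> = \<xi>'"
  unfolding covers_def by (metis le_antisym lt_fields(1) lt_imp_le lt_le_trans lt_irrefl not_le)

text \<open>Recursion along the well-order: an element is coloured \<open>True\<close> unless it
  covers a \<open>True\<close> element. By \<open>covers_inj\<close> it covers at most one element,
  so the colour flips at each successor and restarts with \<open>True\<close> at limits.\<close>

lemma alternating_colouring:
  obtains c :: "'a \<Rightarrow> bool" where "\<And>\<xi> \<eta>. covers \<eta> \<xi> \<Longrightarrow> c \<eta> \<noteq> c \<xi>"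
proof -
  define F where "F = (\<lambda>c \<eta>. \<not> (\<exists>\<xi>. covers \<eta> \<xi> \<and> c \<xi>))"
  define c where "c = wfrec {(x, y). x \<prec> y} F"
  have "c \<eta> = F (cut c {(x, y). x \<prec> y} \<eta>) \<eta>" for \<eta>
    unfolding c_def by (rule wfrec[OF wf_lt])
  then have "c \<eta> \<longleftrightarrow> \<not> (\<exists>\<xi>. covers \<eta> \<xi> \<and> c \<xi>)" for \<eta>
    unfolding F_def by (metis (no_types, lifting) case_prodI covers_def cut_apply mem_Collect_eq)
  then show ?thesis using that[of c] covers_inj by blast
qed

text \<open>By recursion, \<open>j \<xi>\<close> is chosen strictly above the set
  \<open>G j \<xi>\<close>, which collects \<xi>, the earlier values of \<open>j\<close> and the
  values of \<open>f\<close> up to those. Regularity keeps this set small, hence bounded.\<close>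

lemma fast_sequence:
  assumes f: "\<And>n. n \<in> \<kappa> \<Longrightarrow> f n \<in> \<kappa>"
  obtains j where "\<And>\<xi>. \<xi> \<in> \<kappa> \<Longrightarrow> \<xi> \<prec> j \<xi>"
    "\<And>\<xi> \<eta>. \<eta> \<prec> \<xi> \<Longrightarrow> j \<eta> \<prec> j \<xi>"
    "\<And>\<xi> \<eta> n. \<eta> \<prec> \<xi> \<Longrightarrow> n \<preceq> j \<eta> \<Longrightarrow> f n \<prec> j \<xi>"
proof -
  define G where "G = (\<lambda>j \<xi>. {\<xi>} \<union> (\<Union>\<eta>\<in>{\<eta>. \<eta> \<prec> \<xi>}. {j \<eta>} \<union> f ` {n. n \<preceq> j \<eta>}))"
  define F where "F = (\<lambda>j \<xi>. SOME b. b \<in> \<kappa> \<and> (\<forall>x\<in>G j \<xi>. x \<prec> b))"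
  define j where "j = wfrec {(x, y). x \<prec> y} F"
  have cong: "F i \<xi> = F i' \<xi>" if "\<And>\<eta>. \<eta> \<prec> \<xi> \<Longrightarrow> i \<eta> = i' \<eta>" for i i' \<xi>
    using that by (simp add: F_def G_def)
  have rec: "j \<xi> = F j \<xi>" for \<xi>
    unfolding j_def by (subst wfrec[OF wf_lt], rule cong) (simp add: cut_apply)
  have j: "j \<xi> \<in> \<kappa> \<and> (\<forall>x\<in>G j \<xi>. x \<prec> j \<xi>)" if "\<xi> \<in> \<kappa>" for \<xi>
    using that
  proof (induction \<xi> rule: wf_induct_rule[OF wf_lt])
    case (1 \<xi>)
    then have IH: "j \<eta> \<in> \<kappa>" if "\<eta> \<prec> \<xi>" for \<eta> using that lt_fields by blast
    have "G j \<xi> \<subseteq> \<kappa>" using 1(2) IH f fields unfolding G_def by blast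
    moreover have "|G j \<xi>| <o r"
      unfolding G_def using 1(2) IH
      by (intro small_Un small_UN small_image small_under small_underS small_finite) auto
    ultimately have "\<exists>b. b \<in> \<kappa> \<and> (\<forall>x\<in>G j \<xi>. x \<prec> b)" using small_bounded by metis
    from someI_ex[OF this] show ?case unfolding rec[of \<xi>] F_def .
  qed
  show ?thesis
  proof (rule that[of j])
    show "\<xi> \<prec> j \<xi>" if "\<xi> \<in> \<kappa>" for \<xi> using j[OF that] by (auto simp: G_def)
    show "j \<eta> \<prec> j \<xi>" if "\<eta> \<prec> \<xi>" for \<eta> \<xi>
      using j[OF lt_fields(2)[OF that]] that by (auto simp: G_def)
    show "f n \<prec> j \<xi>" if "\<eta> \<prec> \<xi>" "n \<preceq> j \<eta>" for \<eta> \<xi> n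
      using j[OF lt_fields(2)[OF that(1)]] that by (auto simp: G_def)
  qed
qed

text \<open>Here \<open>\<rho> m\<close> is the index of the block containing \<open>m\<close> and \<open>c\<close> colours the block indices.\<close>

definition interval_colouring :: "('a \<Rightarrow> 'a) \<Rightarrow> ('a \<Rightarrow> 'a) \<Rightarrow> ('a \<Rightarrow> bool) \<Rightarrow> bool" where
  "interval_colouring f \<rho> c \<longleftrightarrow> (\<forall>m\<in>\<kappa>. \<rho> m \<in> \<kappa>)
    \<and> (\<forall>b\<in>\<kappa>. \<exists>a\<in>\<kappa>. \<forall>m\<in>\<kappa>. \<rho> m \<prec> b \<longrightarrow> m \<prec> a)
    \<and> (\<forall>n m m'. n \<preceq> m \<longrightarrow> m \<preceq> f n \<longrightarrow> n \<preceq> m' \<longrightarrow> m' \<preceq> f n \<longrightarrow> c (\<rho> m) = c (\<rho> m') \<longrightarrow> \<rho> m = \<rho> m')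
    \<and> (\<forall>B\<subseteq>\<kappa>. (\<forall>n\<in>\<kappa>. \<exists>m\<in>B. n \<preceq> m \<and> m \<preceq> f n) \<longrightarrow>
        (\<forall>b\<in>\<kappa>. \<forall>v. \<exists>m\<in>B. b \<preceq> m \<and> c (\<rho> m) = v))"

text \<open>The sequence \<open>j\<close> delimits the blocks: \<open>\<rho> m\<close> is the least
  \<xi> with \<open>m \<prec> j \<xi>\<close>. As \<open>j\<close> outruns \<open>f\<close>, the
  interval from \<open>n\<close> to \<open>f n\<close> lies in the block of \<open>n\<close> and the
  next one, and these two have different colours.\<close>

lemma interval_colouring_exists:
  assumes f: "\<And>n. n \<in> \<kappa> \<Longrightarrow> f n \<in> \<kappa>"
  obtains \<rho> c where "interval_colouring f \<rho> c"
proof -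
  obtain j where j: "\<And>\<xi>. \<xi> \<in> \<kappa> \<Longrightarrow> \<xi> \<prec> j \<xi>" "\<And>\<xi> \<eta>. \<eta> \<prec> \<xi> \<Longrightarrow> j \<eta> \<prec> j \<xi>"
    "\<And>\<xi> \<eta> n. \<eta> \<prec> \<xi> \<Longrightarrow> n \<preceq> j \<eta> \<Longrightarrow> f n \<prec> j \<xi>"
    using fast_sequence[of f] f by metis
  obtain c :: "'a \<Rightarrow> bool" where c: "\<And>\<xi> \<eta>. covers \<eta> \<xi> \<Longrightarrow> c \<eta> \<noteq> c \<xi>"
    using alternating_colouring by blast
  have "\<forall>m\<in>\<kappa>. \<exists>\<xi>. \<xi> \<in> \<kappa> \<and> m \<prec> j \<xi> \<and> (\<forall>\<eta>\<in>\<kappa>. m \<prec> j \<eta> \<longrightarrow> \<xi> \<preceq> \<eta>)"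
  proof
    fix m assume "m \<in> \<kappa>"
    then show "\<exists>\<xi>. \<xi> \<in> \<kappa> \<and> m \<prec> j \<xi> \<and> (\<forall>\<eta>\<in>\<kappa>. m \<prec> j \<eta> \<longrightarrow> \<xi> \<preceq> \<eta>)"
      using least[of m "\<lambda>\<xi>. m \<prec> j \<xi>"] j(1) by metis
  qed
  then obtain \<rho> where \<rho>: "\<And>m. m \<in> \<kappa> \<Longrightarrow> \<rho> m \<in> \<kappa>" "\<And>m. m \<in> \<kappa> \<Longrightarrow> m \<prec> j (\<rho> m)"
    "\<And>m \<eta>. m \<in> \<kappa> \<Longrightarrow> \<eta> \<in> \<kappa> \<Longrightarrow> m \<prec> j \<eta> \<Longrightarrow> \<rho> m \<preceq> \<eta>"
    by metis
  \<comment> \<open>From \<open>n \<prec> j (\<rho> n)\<close> and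
    \<open>\<rho> n \<prec> \<eta>\<close> follows \<open>f n \<prec> j \<eta>\<close>, so
    \<open>m\<close> lies in a block with index at most \<eta>.\<close>
  have near: "\<rho> n \<preceq> \<rho> m \<and> (\<forall>\<eta>. \<rho> n \<prec> \<eta> \<longrightarrow> \<rho> m \<preceq> \<eta>)" if "n \<preceq> m" "m \<preceq> f n" for n m
  proof
    have \<kappa>: "n \<in> \<kappa>" "m \<in> \<kappa>" using that fields by blast+
    show "\<rho> n \<preceq> \<rho> m" using \<rho> \<kappa> that le_lt_trans by blast
    show "\<forall>\<eta>. \<rho> n \<prec> \<eta> \<longrightarrow> \<rho> m \<preceq> \<eta>"
      using \<rho> \<kappa> that j(3) le_lt_trans lt_imp_le lt_fields by meson
  qed
  show ?thesis
  proof (rule that[of \<rho> c], unfold interval_colouring_def, intro conjI ballI allI impI)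
    show "\<rho> m \<in> \<kappa>" if "m \<in> \<kappa>" for m using \<rho> that by blast
    \<comment> \<open>The bound is \<open>j b\<close>, because \<open>m \<prec> j (\<rho> m)\<close>
      and \<open>j\<close> is increasing.\<close>
    show "\<exists>a\<in>\<kappa>. \<forall>m\<in>\<kappa>. \<rho> m \<prec> b \<longrightarrow> m \<prec> a" if "b \<in> \<kappa>" for b
      using \<rho>(2) j(1)[OF that] j(2) lt_fields lt_le_trans lt_imp_le by meson
    show "\<rho> m = \<rho> m'" if *: "n \<preceq> m" "m \<preceq> f n" "n \<preceq> m'" "m' \<preceq> f n" "c (\<rho> m) = c (\<rho> m')" for n m m'
    proof -
      have "\<rho> m = \<rho> n \<or> covers (\<rho> m) (\<rho> n)" "\<rho> m' = \<rho> n \<or> covers (\<rho> m') (\<rho> n)"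
        using near[of n m] near[of n m'] * unfolding covers_def lt_def by metis+
      then show ?thesis using c *(5) covers_unique by metis
    qed
    show "\<exists>m\<in>B. b \<preceq> m \<and> c (\<rho> m) = v"
      if B: "B \<subseteq> \<kappa>" "\<forall>n\<in>\<kappa>. \<exists>m\<in>B. n \<preceq> m \<and> m \<preceq> f n" "b \<in> \<kappa>" for B b v
    proof -
      obtain b' where b': "covers b' b" using covers_exists B(3) by blast
      then have "b' \<in> \<kappa>" using lt_fields unfolding covers_def by blast
      then obtain b'' where b'': "covers b'' b'" using covers_exists by blast
      \<comment> \<open>The two successive successors of \<open>b\<close> have opposite colours, so
        one of them serves as \<eta>.\<close>
      have "\<exists>\<xi> \<eta>. covers \<eta> \<xi> \<and> b \<preceq> \<xi> \<and> c \<eta> = v"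
        using b' b'' c le_refl[OF B(3)] lt_imp_le unfolding covers_def by metis
      then obtain \<xi> \<eta> where \<xi>: "covers \<eta> \<xi>" "b \<preceq> \<xi>" "c \<eta> = v" by blast
      then have \<kappa>: "\<xi> \<in> \<kappa>" "\<eta> \<in> \<kappa>" "\<xi> \<prec> \<eta>" using lt_fields unfolding covers_def by blast+
      then have "j \<xi> \<in> \<kappa>" using j(1) lt_fields by blast
      \<comment> \<open>The interval starting at \<open>j \<xi>\<close> ends before
        \<open>j \<eta>\<close>, so the point of \<open>B\<close> in it must lie in block
        \<eta>.\<close>
      then obtain m where m: "m \<in> B" "j \<xi> \<preceq> m" "m \<preceq> f (j \<xi>)" using B by blast
      then have "m \<in> \<kappa>" using B by blast
      have "m \<prec> j \<eta>" using j(3)[OF \<kappa>(3) le_refl[OF \<open>j \<xi> \<in> \<kappa>\<close>]] m le_lt_trans by blast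
      then have "\<rho> m \<preceq> \<eta>" using \<rho> \<open>m \<in> \<kappa>\<close> \<kappa> by blast
      moreover have "\<not> \<rho> m \<preceq> \<xi>"
      proof
        assume "\<rho> m \<preceq> \<xi>"
        then have "j (\<rho> m) \<preceq> j \<xi>"
          using j(2)[of "\<rho> m" \<xi>] le_refl[OF \<open>j \<xi> \<in> \<kappa>\<close>] unfolding lt_def by metis
        then show False
          using \<rho>(2)[OF \<open>m \<in> \<kappa>\<close>] m(2) le_lt_trans lt_le_trans lt_irrefl by blast
      qed
      ultimately have "\<rho> m = \<eta>"
        using \<xi>(1) not_le \<rho>(1)[OF \<open>m \<in> \<kappa>\<close>] \<kappa> le_antisym unfolding covers_def by blast
      moreover have "b \<preceq> m" using \<xi>(2) j(1)[OF \<kappa>(1)] m(2) le_trans lt_imp_le by blast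
      ultimately show ?thesis using m(1) \<xi>(3) by blast
    qed
  qed
qed

section \<open>Unsplit families and their lower bounds\<close>

text \<open>No set splits itself. This supplies the witness that makes the minimum defining the
  reaping number meaningful.\<close>

lemma kappa_subsets_unsplit: "unsplit_family r (kappa_subsets r)"
proof -
  have "\<not> splits r S S" for S
    using small_finite[of "{} :: 'a set"] not_ordLess_ordIso by (auto simp: splits_def)
  then show ?thesis unfolding unsplit_family_def by blast
qed

text \<open>A set \<open>S\<close> deciding no member would split them all. This form admits every
  \<open>S \<subseteq> \<kappa>\<close>: the family is nonempty, since otherwise \<kappa> would
  split it vacuously, and a small \<open>S\<close> has a small trace on any member.\<close>

lemma unsplit_decides:
  assumes \<A>: "unsplit_family r \<A>" and S: "S \<subseteq> \<kappa>"
  obtains B where "B \<in> \<A>" "|S \<inter> B| <o r \<or> |B - S| <o r"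
proof (rule ccontr)
  note found = that
  assume neg: "\<not> thesis"
  have no: "\<not> |S \<inter> B| <o r" "\<not> |B - S| <o r" if "B \<in> \<A>" for B
    using neg found \<open>B \<in> \<A>\<close> by blast+
  have sub: "B \<subseteq> \<kappa>" if "B \<in> \<A>" for B
    using that \<A> kappa_subsetsD unfolding unsplit_family_def by blast
  have "\<A> \<noteq> {}" using \<A> kappa_large unfolding unsplit_family_def by blast
  then obtain B where "B \<in> \<A>" by blast
  then have "S \<in> kappa_subsets r"
    using no(1)[of B] small_mono[of S "S \<inter> B"] S by (intro kappa_subsetsI) auto
  moreover have "splits r S B" if "B \<in> \<A>" for B
    using no[OF that] sub[OF that] S not_small[of "S \<inter> B"] not_small[of "B - S"]
    unfolding splits_def by blast
  ultimately show False using \<A> unfolding unsplit_family_def by blast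
qed

lemma uniform_ultrafilterD:
  assumes "uniform_ultrafilter r U"
  shows "U \<subseteq> kappa_subsets r"
    "\<And>X Y. X \<in> U \<Longrightarrow> X \<subseteq> Y \<Longrightarrow> Y \<subseteq> \<kappa> \<Longrightarrow> Y \<in> U"
    "\<And>X Y. X \<in> U \<Longrightarrow> Y \<in> U \<Longrightarrow> X \<inter> Y \<in> U"
    "\<And>X. X \<subseteq> \<kappa> \<Longrightarrow> X \<in> U \<or> \<kappa> - X \<in> U"
    "\<kappa> \<in> U"
proof -
  note U = assms[unfolded uniform_ultrafilter_def]
  have "U \<subseteq> Pow \<kappa>" "\<forall>X\<in>U. |X| =o r" using U by simp_all
  then show "U \<subseteq> kappa_subsets r" by (auto simp: kappa_subsets_def)
  have "\<forall>X\<in>U. \<forall>Y. X \<subseteq> Y \<and> Y \<subseteq> \<kappa> \<longrightarrow> Y \<in> U" using U by simp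
  then show "\<And>X Y. X \<in> U \<Longrightarrow> X \<subseteq> Y \<Longrightarrow> Y \<subseteq> \<kappa> \<Longrightarrow> Y \<in> U" by simp
qed (use assms in \<open>simp_all add: uniform_ultrafilter_def\<close>)

text \<open>The ultrafilter contains \<open>S\<close> or its complement, and a base element inside
  that set is not split by \<open>S\<close>. This is the inequality of the reaping number below the
  ultrafilter number.\<close>

lemma base_unsplit:
  assumes "uniform_ultrafilter_base r \<B>"
  shows "unsplit_family r \<B>"
proof -
  from assms obtain U where U: "uniform_ultrafilter r U" and \<B>: "is_base U \<B>"
    unfolding uniform_ultrafilter_base_def by blast
  have "\<B> \<subseteq> kappa_subsets r"
    using uniform_ultrafilterD(1)[OF U] \<B> unfolding is_base_def by blast
  moreover have "\<exists>B\<in>\<B>. \<not> splits r S B" if "S \<subseteq> \<kappa>" for S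
  proof -
    have "S \<in> U \<or> \<kappa> - S \<in> U" using uniform_ultrafilterD(4)[OF U that] .
    then obtain B where "B \<in> \<B>" "B \<subseteq> S \<or> B \<subseteq> \<kappa> - S" using \<B> unfolding is_base_def by blast
    moreover from this have "B - S = {} \<or> S \<inter> B = {}" by blast
    ultimately show ?thesis
      using small_finite[of "{} :: 'a set"] not_ordLess_ordIso unfolding splits_def
      by (metis finite.emptyI)
  qed
  ultimately show ?thesis
    using kappa_subsetsD(1) unfolding unsplit_family_def by blast
qed

definition nxt where "nxt B n = (SOME m. m \<in> B \<and> n \<preceq> m)"

lemma nxt:
  assumes "B \<in> kappa_subsets r" "n \<in> \<kappa>"
  shows "nxt B n \<in> B" "n \<preceq> nxt B n" "nxt B n \<in> \<kappa>"
proof -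
  have "\<exists>m. m \<in> B \<and> n \<preceq> m"
    using large_unbounded[of B n] assms kappa_subsetsD by metis
  from someI_ex[OF this] show "nxt B n \<in> B" "n \<preceq> nxt B n" unfolding nxt_def by auto
  then show "nxt B n \<in> \<kappa>" using fields by blast
qed

text \<open>With fewer than \<kappa> members, regularity bounds all \<open>nxt B n\<close> by one
  \<open>f n\<close>, so every member meets every interval from \<open>n\<close> to
  \<open>f n\<close>. Each member then meets both colours of blocks unboundedly, and the set
  \<open>S\<close> of points of colour \<open>True\<close> splits the whole family.\<close>

lemma kappa_le_unsplit:
  assumes "unsplit_family r \<A>"
  shows "r \<le>o |\<A>|"
proof (rule ccontr)
  assume "\<not> ?thesis"
  then have small: "|\<A>| <o r" using not_ordLeq_iff_ordLess Well card_of_Well_order by blast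
  have sub: "\<A> \<subseteq> kappa_subsets r" using assms by (simp add: unsplit_family_def)
  have "\<forall>n\<in>\<kappa>. \<exists>b. b \<in> \<kappa> \<and> (\<forall>B\<in>\<A>. nxt B n \<prec> b)"
  proof
    fix n assume "n \<in> \<kappa>"
    then show "\<exists>b. b \<in> \<kappa> \<and> (\<forall>B\<in>\<A>. nxt B n \<prec> b)"
      using small_bounded[of "(\<lambda>B. nxt B n) ` \<A>"] small_image[OF small] nxt(3) sub
      by (metis (no_types, lifting) image_eqI image_subsetI subsetD)
  qed
  then obtain f where f: "\<And>n. n \<in> \<kappa> \<Longrightarrow> f n \<in> \<kappa>" "\<And>n B. n \<in> \<kappa> \<Longrightarrow> B \<in> \<A> \<Longrightarrow> nxt B n \<prec> f n"
    by metis
  obtain \<rho> c where "interval_colouring f \<rho> c"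
    using interval_colouring_exists f(1) by blast
  then have \<rho>: "\<forall>B\<subseteq>\<kappa>. (\<forall>n\<in>\<kappa>. \<exists>m\<in>B. n \<preceq> m \<and> m \<preceq> f n) \<longrightarrow>
      (\<forall>b\<in>\<kappa>. \<forall>v. \<exists>m\<in>B. b \<preceq> m \<and> c (\<rho> m) = v)"
    by (simp add: interval_colouring_def)
  define S where "S = {m \<in> \<kappa>. c (\<rho> m)}"
  obtain B where B: "B \<in> \<A>" and dec: "|S \<inter> B| <o r \<or> |B - S| <o r"
    using unsplit_decides[OF assms, of S] unfolding S_def by blast
  have B\<kappa>: "B \<subseteq> \<kappa>" using B sub kappa_subsetsD by blast
  have meet: "\<exists>m\<in>B. n \<preceq> m \<and> m \<preceq> f n" if "n \<in> \<kappa>" for n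
    using nxt[of B n] f(2)[OF that B] that B sub lt_imp_le by blast
  have "\<exists>m\<in>B. b \<preceq> m \<and> c (\<rho> m) = v" if "b \<in> \<kappa>" for b v
    using \<rho> meet B\<kappa> that by simp
  then have large: "|{m\<in>B. c (\<rho> m) = v}| =o r" for v
    using B\<kappa> by (intro unbounded_large) blast+
  have pieces: "S \<inter> B = {m\<in>B. c (\<rho> m) = True}" "B - S = {m\<in>B. c (\<rho> m) = False}"
    using B\<kappa> by (auto simp: S_def)
  have "|S \<inter> B| =o r" "|B - S| =o r" unfolding pieces by (rule large)+
  then show False using dec not_ordLess_ordIso by blast
qed

section \<open>From an unsplit family to a pi-base\<close>

text \<open>A bijection \<open>e A\<close> carries the unsplit family into \<open>A\<close>, where
  some image is decided by \<open>S\<close> up to a small set. Closing off in \<omega> steps adds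
  \<open>|\<A>|\<close> times \<open>|\<A>|\<close> times \<kappa> sets at most at each step, which
  is no more than \<open>|\<A>|\<close> because \<kappa> is at most \<open>|\<A>|\<close>.\<close>

lemma hereditary_unsplit:
  assumes \<A>: "unsplit_family r \<A>"
  obtains \<F> where "\<F> \<subseteq> kappa_subsets r" "infinite \<F>" "|\<F>| \<le>o |\<A>|"
    "\<And>A S. A \<in> \<F> \<Longrightarrow> \<exists>B\<in>\<F>. B \<subseteq> A \<and> (B \<subseteq> S \<or> B \<inter> S = {})"
proof -
  have sub: "\<A> \<subseteq> kappa_subsets r" using \<A> by (simp add: unsplit_family_def)
  have \<kappa>\<A>: "|\<kappa>| \<le>o |\<A>|"
    using kappa_le_unsplit[OF \<A>] card_of_Field_ordIso[OF Card] ordIso_ordLeq_trans by blast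
  then have inf\<A>: "infinite \<A>" using inf card_of_ordLeq_infinite by blast
  have "\<exists>e. bij_betw e \<kappa> A" if "A \<in> kappa_subsets r" for A
    using kappa_subsetsD(2)[OF that] card_of_Field_ordIso[OF Card] card_of_ordIso
      ordIso_symmetric ordIso_transitive by metis
  then obtain e where e: "\<And>A. A \<in> kappa_subsets r \<Longrightarrow> bij_betw (e A) \<kappa> A" by metis
  \<comment> \<open>Small sets are bounded, so deleting initial segments suffices to remove every
    exceptional part, and there are only \<kappa> of them.\<close>
  define step where "step = (\<lambda>\<G>. \<G> \<union>
    (\<lambda>((A, B), a). e A ` B - {x. x \<prec> a}) ` ((\<G> \<times> \<A>) \<times> \<kappa>))"
  define G where "G n = (step ^^ n) \<A>" for n
  have G0: "G 0 = \<A>" and GSuc: "G (Suc n) = step (G n)" for n by (simp_all add: G_def)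
  have img: "e A ` B \<in> kappa_subsets r" if "A \<in> kappa_subsets r" "B \<in> kappa_subsets r" for A B
  proof -
    have "bij_betw (e A) B (e A ` B)"
      using e[OF that(1)] kappa_subsetsD(1)[OF that(2)] bij_betw_subset by blast
    then have "|e A ` B| =o r"
      using kappa_subsetsD(2)[OF that(2)] card_of_ordIso ordIso_symmetric ordIso_transitive by metis
    moreover have "e A ` B \<subseteq> \<kappa>"
      using e[OF that(1)] kappa_subsetsD(1)[OF that(2)] kappa_subsetsD(1)[OF that(1)]
      unfolding bij_betw_def by blast
    ultimately show ?thesis by (simp add: kappa_subsets_def)
  qed
  have Gsub: "G n \<subseteq> kappa_subsets r" for n
  proof (induction n)
    case 0 then show ?case using sub G0 by simp
  next
    case (Suc n)
    then show ?case unfolding GSuc step_def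
      using sub by (auto intro!: large_diff_small[OF img small_underS])
  qed
  have Gcard: "|G n| \<le>o |\<A>|" for n
  proof (induction n)
    case 0 then show ?case by (simp add: G0 card_of_mono1)
  next
    case (Suc n)
    have F: "infinite (Field |\<A>| )" "Card_order |\<A>|"
      using inf\<A> card_of_Card_order by (simp_all add: Field_card_of)
    have "|(G n \<times> \<A>) \<times> \<kappa>| \<le>o |\<A>|"
      using Suc \<kappa>\<A> F by (intro card_of_Times_ordLeq_infinite_Field) (simp_all add: card_of_mono1)
    then have "|(\<lambda>((A, B), a). e A ` B - {x. x \<prec> a}) ` ((G n \<times> \<A>) \<times> \<kappa>)| \<le>o |\<A>|"
      using card_of_image ordLeq_transitive by blast
    then show ?case unfolding GSuc step_def
      using card_of_Un_ordLeq_infinite_Field[OF F(1) Suc _ F(2)] by blast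
  qed
  define \<F> where "\<F> = (\<Union>n. G n)"
  have "|UNIV :: nat set| \<le>o |\<A>|" using inf\<A> infinite_iff_card_of_nat by blast
  then have card: "|\<F>| \<le>o |\<A>|"
    unfolding \<F>_def using card_of_UNION_ordLeq_infinite[OF inf\<A>] Gcard by blast
  have "\<A> \<subseteq> \<F>" using G0 unfolding \<F>_def by blast
  then have "infinite \<F>" using inf\<A> infinite_super by blast
  moreover have "\<exists>B\<in>\<F>. B \<subseteq> A \<and> (B \<subseteq> S \<or> B \<inter> S = {})" if "A \<in> \<F>" for A S
  proof -
    from that obtain n where n: "A \<in> G n" unfolding \<F>_def by blast
    then have A: "A \<in> kappa_subsets r" using Gsub by blast
    \<comment> \<open>The preimage of \<open>S\<close> under \<open>e A\<close>; a member of
      \<open>\<A>\<close> deciding it has an image deciding \<open>S\<close> inside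
      \<open>A\<close>.\<close>
    define T where "T = {x \<in> \<kappa>. e A x \<in> S}"
    obtain B where B: "B \<in> \<A>" and dec: "|T \<inter> B| <o r \<or> |B - T| <o r"
      using unsplit_decides[OF \<A>, of T] unfolding T_def by blast
    have B\<kappa>: "B \<subseteq> \<kappa>" using B sub kappa_subsetsD by blast
    have eA: "e A ` B \<subseteq> A" using e[OF A] B\<kappa> unfolding bij_betw_def by blast
    have A\<kappa>: "A \<subseteq> \<kappa>" using A kappa_subsetsD by blast
    have "e A ` B \<inter> S \<subseteq> e A ` (T \<inter> B)" "e A ` B - S \<subseteq> e A ` (B - T)"
      using B\<kappa> unfolding T_def by blast+
    then have "|e A ` B \<inter> S| <o r \<or> |e A ` B - S| <o r"
      using dec small_mono[OF small_image[of "T \<inter> B" "e A"]]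
        small_mono[OF small_image[of "B - T" "e A"]] by metis
    then obtain a where a: "a \<in> \<kappa>"
      "(\<forall>x \<in> e A ` B \<inter> S. x \<prec> a) \<or> (\<forall>x \<in> e A ` B - S. x \<prec> a)"
    proof
      assume "|e A ` B \<inter> S| <o r"
      moreover have "e A ` B \<inter> S \<subseteq> \<kappa>" using eA A\<kappa> by blast
      ultimately show ?thesis using small_bounded that by metis
    next
      assume "|e A ` B - S| <o r"
      moreover have "e A ` B - S \<subseteq> \<kappa>" using eA A\<kappa> by blast
      ultimately show ?thesis using small_bounded that by metis
    qed
    let ?C = "e A ` B - {x. x \<prec> a}"
    have "((A, B), a) \<in> (G n \<times> \<A>) \<times> \<kappa>" using n B a by blast
    then have "?C \<in> G (Suc n)" unfolding GSuc step_def by (intro UnI2 image_eqI) auto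
    then have "?C \<in> \<F>" unfolding \<F>_def by blast
    moreover have "?C \<subseteq> A" "?C \<subseteq> S \<or> ?C \<inter> S = {}" using eA a(2) by blast+
    ultimately show ?thesis by blast
  qed
  moreover have "\<F> \<subseteq> kappa_subsets r" using Gsub unfolding \<F>_def by blast
  ultimately show ?thesis using that card by blast
qed

text \<open>Containing a member of \<open>\<F>\<close> is partition regular: a member inside
  \<open>A \<union> B\<close> has a refinement that lies inside \<open>A\<close> or misses
  \<open>A\<close>, and then lies inside \<open>B\<close>.\<close>

lemma pi_base_ultrafilter:
  assumes sub: "\<F> \<subseteq> kappa_subsets r" and ne: "\<F> \<noteq> {}"
    and her: "\<And>A S. A \<in> \<F> \<Longrightarrow> \<exists>B\<in>\<F>. B \<subseteq> A \<and> (B \<subseteq> S \<or> B \<inter> S = {})"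
  obtains U where "uniform_ultrafilter r U" "\<And>X. X \<in> U \<Longrightarrow> \<exists>A\<in>\<F>. A \<subseteq> X"
proof -
  define P where "P X \<longleftrightarrow> (\<exists>A\<in>\<F>. A \<subseteq> X)" for X
  have large: "\<not> |X| <o r" if "P X" for X
    using that sub kappa_subsetsD(3) small_mono unfolding P_def by blast
  have top: "P \<kappa>" using sub ne kappa_subsetsD(1) unfolding P_def by blast
  have empty: "\<not> P {}" using large small_finite by blast
  have mono: "P B" if "P A" "A \<subseteq> B" for A B using that unfolding P_def by blast
  have part: "P A \<or> P B" if "P (A \<union> B)" for A B
  proof -
    from that obtain C where "C \<in> \<F>" "C \<subseteq> A \<union> B" unfolding P_def by blast
    moreover from this obtain D where "D \<in> \<F>" "D \<subseteq> C" "D \<subseteq> A \<or> D \<inter> A = {}"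
      using her by blast
    ultimately show ?thesis unfolding P_def by blast
  qed
  from ultrafilter_of_partition_regular[of P \<kappa>, OF top mono part]
  obtain U where U: "U \<subseteq> Pow \<kappa> \<and> \<kappa> \<in> U \<and> (\<forall>A\<in>U. P A)
    \<and> (\<forall>A\<in>U. \<forall>B. A \<subseteq> B \<and> B \<subseteq> \<kappa> \<longrightarrow> B \<in> U) \<and> (\<forall>A\<in>U. \<forall>B\<in>U. A \<inter> B \<in> U)
    \<and> (\<forall>A. A \<subseteq> \<kappa> \<longrightarrow> A \<in> U \<or> \<kappa> - A \<in> U)" ..
  then have U': "U \<subseteq> Pow \<kappa>" "\<And>X. X \<in> U \<Longrightarrow> P X" by simp_all
  have "{} \<notin> U" using U'(2) empty by blast
  moreover have "\<forall>X\<in>U. |X| =o r" using U' large not_small by blast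
  ultimately have "uniform_ultrafilter r U"
    unfolding uniform_ultrafilter_def using U by simp
  then show ?thesis using that U'(2) unfolding P_def by blast
qed

section \<open>Ultrafilter bases from families smaller than the dominating number\<close>

text \<open>For each pair let \<open>h\<close> send \<open>n\<close> to the larger of
  \<open>nxt A n\<close> and \<open>nxt A' n\<close>. As \<open>\<F>\<close> is infinite, there are
  at most \<open>|\<F>|\<close> such functions, too few to dominate. An undominated \<open>f\<close>
  exceeds each of them somewhere, and there its interval meets both sets.\<close>

lemma common_intervals:
  assumes sub: "\<F> \<subseteq> kappa_subsets r" and inf\<F>: "infinite \<F>"
    and less: "|\<F>| <o dominating_number r"
  obtains f where "\<And>n. n \<in> \<kappa> \<Longrightarrow> f n \<in> \<kappa>"
    "\<And>A A'. A \<in> \<F> \<Longrightarrow> A' \<in> \<F> \<Longrightarrow> \<exists>n. \<exists>m\<in>A. \<exists>m'\<in>A'. n \<preceq> m \<and> m \<preceq> f n \<and> n \<preceq> m' \<and> m' \<preceq> f n"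
proof -
  define h where "h = (\<lambda>(A, A'). \<lambda>n\<in>\<kappa>. if nxt A n \<preceq> nxt A' n then nxt A' n else nxt A n)"
  have "h p \<in> kappa_funs r" if "p \<in> \<F> \<times> \<F>" for p
    using that nxt(3) sub unfolding h_def kappa_funs_def by fastforce
  then have funs: "h ` (\<F> \<times> \<F>) \<subseteq> kappa_funs r" by blast
  have "|\<F> \<times> \<F>| \<le>o |\<F>|"
    using card_of_Times_same_infinite[OF inf\<F>] ordIso_iff_ordLeq by blast
  then have "|h ` (\<F> \<times> \<F>)| \<le>o |\<F>|" using card_of_image ordLeq_transitive by blast
  then have "|h ` (\<F> \<times> \<F>)| <o dominating_number r" using less ordLeq_ordLess_trans by blast
  then have "\<not> dominating_family r (h ` (\<F> \<times> \<F>))"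
    using mincard_le not_ordLess_ordLeq unfolding dominating_number_def by blast
  then obtain f where f: "f \<in> kappa_funs r" "\<And>p. p \<in> \<F> \<times> \<F> \<Longrightarrow> \<not> le_star r f (h p)"
    using funs unfolding dominating_family_def by blast
  have "\<exists>n. \<exists>m\<in>A. \<exists>m'\<in>A'. n \<preceq> m \<and> m \<preceq> f n \<and> n \<preceq> m' \<and> m' \<preceq> f n" if A: "A \<in> \<F>" "A' \<in> \<F>" for A A'
  proof -
    have "{n \<in> \<kappa>. h (A, A') n \<preceq> f n \<and> h (A, A') n \<noteq> f n} \<noteq> {}"
      using f(2)[of "(A, A')"] A small_finite[of "{} :: 'a set"] unfolding le_star_def by force
    then obtain n where n: "n \<in> \<kappa>" "h (A, A') n \<preceq> f n" by blast
    have \<kappa>: "nxt A n \<in> \<kappa>" "nxt A' n \<in> \<kappa>" using nxt(3) sub A n(1) by blast+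
    have "nxt A n \<preceq> h (A, A') n" "nxt A' n \<preceq> h (A, A') n"
      using n(1) \<kappa> le_refl lt_imp_le not_le unfolding h_def by auto
    then have "nxt A n \<preceq> f n" "nxt A' n \<preceq> f n" using n(2) le_trans by blast+
    then show ?thesis using nxt(1,2) sub A n(1) by blast
  qed
  moreover have "f n \<in> \<kappa>" if "n \<in> \<kappa>" for n using f(1) that unfolding kappa_funs_def by blast
  ultimately show ?thesis using that by blast
qed

lemma small_ultrafilter_base:
  assumes sub: "\<F> \<subseteq> kappa_subsets r" and inf\<F>: "infinite \<F>"
    and her: "\<And>A S. A \<in> \<F> \<Longrightarrow> \<exists>B\<in>\<F>. B \<subseteq> A \<and> (B \<subseteq> S \<or> B \<inter> S = {})"
    and less: "|\<F>| <o dominating_number r"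
  obtains \<B> where "uniform_ultrafilter_base r \<B>" "|\<B>| \<le>o |\<F>|"
proof -
  obtain U where U: "uniform_ultrafilter r U" and pi: "\<And>X. X \<in> U \<Longrightarrow> \<exists>A\<in>\<F>. A \<subseteq> X"
    using pi_base_ultrafilter[of \<F>] sub inf\<F> her by (metis finite.emptyI)
  note UD = uniform_ultrafilterD[OF U]
  obtain f where f: "\<And>n. n \<in> \<kappa> \<Longrightarrow> f n \<in> \<kappa>"
    "\<And>A A'. A \<in> \<F> \<Longrightarrow> A' \<in> \<F> \<Longrightarrow> \<exists>n. \<exists>m\<in>A. \<exists>m'\<in>A'. n \<preceq> m \<and> m \<preceq> f n \<and> n \<preceq> m' \<and> m' \<preceq> f n"
    using common_intervals[OF sub inf\<F> less] by metis
  obtain \<rho> c where \<rho>c: "interval_colouring f \<rho> c"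
    using interval_colouring_exists f(1) by blast
  then have \<rho>: "\<And>m. m \<in> \<kappa> \<Longrightarrow> \<rho> m \<in> \<kappa>"
    and bdd: "\<And>b. b \<in> \<kappa> \<Longrightarrow> \<exists>a\<in>\<kappa>. \<forall>m\<in>\<kappa>. \<rho> m \<prec> b \<longrightarrow> m \<prec> a"
    by (simp_all add: interval_colouring_def)
  have same: "\<And>n m m'. n \<preceq> m \<Longrightarrow> m \<preceq> f n \<Longrightarrow> n \<preceq> m' \<Longrightarrow> m' \<preceq> f n \<Longrightarrow> c (\<rho> m) = c (\<rho> m')
      \<Longrightarrow> \<rho> m = \<rho> m'"
    using \<rho>c[unfolded interval_colouring_def, THEN conjunct2, THEN conjunct2, THEN conjunct1] by blast
  define D where "D v = {m \<in> \<kappa>. c (\<rho> m) = v}" for v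
  have "D True \<in> U \<or> \<kappa> - D True \<in> U" by (rule UD(4)) (auto simp: D_def)
  moreover have "\<kappa> - D True = D False" by (auto simp: D_def)
  ultimately obtain v where v: "D v \<in> U" by metis
  \<comment> \<open>Since \<open>D v\<close> lies in \<open>U\<close>, the members of
    \<open>\<F>\<close> inside it still form a pi-base of \<open>U\<close>.\<close>
  define \<F>0 where "\<F>0 = {A \<in> \<F>. A \<subseteq> D v}"
  have meet: "\<rho> ` A \<inter> \<rho> ` A' \<noteq> {}" if A: "A \<in> \<F>0" "A' \<in> \<F>0" for A A'
  proof -
    obtain n m m' where *: "m \<in> A" "m' \<in> A'" "n \<preceq> m" "m \<preceq> f n" "n \<preceq> m'" "m' \<preceq> f n"
      using f(2)[of A A'] A unfolding \<F>0_def by blast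
    moreover have "c (\<rho> m) = c (\<rho> m')" using * A unfolding \<F>0_def D_def by blast
    ultimately have "\<rho> m = \<rho> m'" using same by blast
    with * show ?thesis by blast
  qed
  define inv where "inv Y = {m \<in> \<kappa>. \<rho> m \<in> Y}" for Y
  \<comment> \<open>The image ultrafilter of \<open>U\<close> under \<rho>.\<close>
  define V where "V = {Y. Y \<subseteq> \<kappa> \<and> inv Y \<in> U}"
  have base: "\<exists>A\<in>\<F>0. \<rho> ` A \<subseteq> Y" if "Y \<in> V" for Y
  proof -
    have "inv Y \<inter> D v \<in> U" using that v UD(3) unfolding V_def by blast
    then obtain A where "A \<in> \<F>" "A \<subseteq> inv Y \<inter> D v" using pi by blast
    then show ?thesis unfolding \<F>0_def inv_def by blast
  qed
  have ultra: "Y \<in> V \<or> \<kappa> - Y \<in> V" if "Y \<subseteq> \<kappa>" for Y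
  proof -
    have "inv (\<kappa> - Y) = \<kappa> - inv Y" using \<rho> by (auto simp: inv_def)
    moreover have "inv Y \<in> U \<or> \<kappa> - inv Y \<in> U" by (rule UD(4)) (auto simp: inv_def)
    ultimately show ?thesis using that unfolding V_def by auto
  qed
  \<comment> \<open>Preimages of bounded sets under \<rho> are bounded, so a small set in
    \<open>V\<close> would put a small set into \<open>U\<close>.\<close>
  have unif: "|Y| =o r" if "Y \<in> V" for Y
  proof (rule ccontr)
    have Y: "Y \<subseteq> \<kappa>" "inv Y \<in> U" using that by (auto simp: V_def)
    assume "\<not> |Y| =o r"
    then have "|Y| <o r" using not_small Y(1) by blast
    then obtain b where b: "b \<in> \<kappa>" "\<And>y. y \<in> Y \<Longrightarrow> y \<prec> b" using small_bounded Y(1) by blast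
    then obtain a where "a \<in> \<kappa>" "\<forall>m\<in>\<kappa>. \<rho> m \<prec> b \<longrightarrow> m \<prec> a" using bdd by blast
    then have "|inv Y| <o r" using b by (intro bounded_small[of a]) (auto simp: inv_def)
    then show False using UD(1) Y(2) kappa_subsetsD(3) by blast
  qed
  have "inv \<kappa> = \<kappa>" using \<rho> by (auto simp: inv_def)
  then have "\<kappa> \<in> V" using UD(5) by (simp add: V_def)
  moreover have "{} \<notin> V" using unif small_finite[of "{} :: 'a set"] not_ordLess_ordIso by blast
  moreover have "Y \<in> V" if "X \<in> V" "X \<subseteq> Y" "Y \<subseteq> \<kappa>" for X Y
  proof -
    have "inv X \<subseteq> inv Y" "inv Y \<subseteq> \<kappa>" using that by (auto simp: inv_def)
    then show ?thesis using that UD(2) unfolding V_def by blast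
  qed
  moreover have "X \<inter> Y \<in> V" if "X \<in> V" "Y \<in> V" for X Y
  proof -
    have "inv (X \<inter> Y) = inv X \<inter> inv Y" by (auto simp: inv_def)
    then show ?thesis using that UD(3) by (auto simp: V_def)
  qed
  moreover have "V \<subseteq> Pow \<kappa>" by (auto simp: V_def)
  ultimately have V: "uniform_ultrafilter r V"
    unfolding uniform_ultrafilter_def using unif ultra by (intro conjI ballI allI impI) simp_all
  have "\<rho> ` A \<in> V" if A: "A \<in> \<F>0" for A
  proof (rule ccontr)
    assume "\<rho> ` A \<notin> V"
    moreover have "\<rho> ` A \<subseteq> \<kappa>" using A \<rho> unfolding \<F>0_def D_def by blast
    ultimately have "\<kappa> - \<rho> ` A \<in> V" using ultra by blast
    then obtain A' where "A' \<in> \<F>0" "\<rho> ` A' \<subseteq> \<kappa> - \<rho> ` A" using base by blast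
    then show False using meet[OF A] by blast
  qed
  then have "(`) \<rho> ` \<F>0 \<subseteq> V" by blast
  then have "is_base V ((`) \<rho> ` \<F>0)" using base unfolding is_base_def by simp
  then have "uniform_ultrafilter_base r ((`) \<rho> ` \<F>0)"
    using V unfolding uniform_ultrafilter_base_def by blast
  moreover have "|(`) \<rho> ` \<F>0| \<le>o |\<F>|"
    using card_of_image[of _ \<F>0] card_of_mono1[of \<F>0 \<F>] ordLeq_transitive
    unfolding \<F>0_def by blast
  ultimately show ?thesis using that by blast
qed

section \<open>Uncountable cofinality of the reaping number\<close>

lemma split_small_family:
  assumes "\<G> \<subseteq> kappa_subsets r" "|\<G>| <o reaping_number r"
  obtains S where "S \<subseteq> \<kappa>" "\<And>B. B \<in> \<G> \<Longrightarrow> splits r S B"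
proof -
  have "\<not> unsplit_family r \<G>"
    using assms(2) mincard_le not_ordLess_ordLeq unfolding reaping_number_def by blast
  then show ?thesis using assms(1) that kappa_subsetsD(1) unfolding unsplit_family_def by metis
qed

lemma splits_nonempty:
  assumes "splits r S B"
  shows "S \<inter> B \<noteq> {}" "B - S \<noteq> {}"
  using assms small_finite[of "{} :: 'a set"] not_ordLess_ordIso unfolding splits_def by force+

lemma uncountable_cofinality:
  assumes U: "uniform_ultrafilter r U" and \<B>: "is_base U \<B>" and card: "|\<B>| =o reaping_number r"
    and K: "K \<subseteq> Field (reaping_number r)" "cofinal K (reaping_number r)"
  shows "natLeq <o |K|"
proof (rule ccontr)
  define q where "q = reaping_number r"
  assume "\<not> natLeq <o |K|"
  then have "|K| \<le>o natLeq"
    using ordLess_or_ordLeq natLeq_Well_order card_of_Well_order by blast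
  then have K_nat: "|K| \<le>o |UNIV :: nat set|"
    using card_of_nat ordIso_symmetric ordLeq_ordIso_trans by blast
  obtain M where M: "unsplit_family r M" "q = |M|"
    using mincard_attained[of "unsplit_family r", OF kappa_subsets_unsplit]
    unfolding q_def reaping_number_def by metis
  have q: "Card_order q" using M(2) card_of_Card_order by simp
  have "|\<kappa>| \<le>o |M|"
    using kappa_le_unsplit[OF M(1)] card_of_Field_ordIso[OF Card] ordIso_ordLeq_trans by blast
  then have infq: "infinite (Field q)"
    using inf card_of_ordLeq_infinite unfolding M(2) Field_card_of by blast
  then have "K \<noteq> {}" using K(2) unfolding cofinal_def q_def by force
  then obtain k :: "nat \<Rightarrow> 'a set" where k: "range k = K"
    using K_nat card_of_ordLeq2[of K "UNIV :: nat set"] by metis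
  have "|Field q| =o |\<B>|"
    using card card_of_Field_ordIso[OF q] ordIso_symmetric ordIso_transitive unfolding q_def by blast
  then obtain b where b: "bij_betw b (Field q) \<B>" using card_of_ordIso by blast
  \<comment> \<open>Finite unions of proper initial segments make the sequence increasing while each
    term stays below the infinite cardinal \<open>q\<close>; cofinality of \<open>K\<close> makes
    the terms exhaust \<open>Field q\<close>.\<close>
  define I where "I n = (\<Union>m\<le>n. underS q (k m))" for n
  have "|I n| <o q" for n
  proof (induction n)
    case 0
    show ?case using card_of_underS[OF q] k K(1) unfolding I_def q_def by auto
  next
    case (Suc n)
    have "|underS q (k (Suc n))| <o q" using card_of_underS[OF q] k K(1) unfolding q_def by blast
    moreover have "I (Suc n) = I n \<union> underS q (k (Suc n))"
      unfolding I_def by (auto simp: atMost_Suc)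
    ultimately show ?case using card_of_Un_ordLess_infinite_Field[OF infq q Suc] by simp
  qed
  moreover define \<B>n where "\<B>n n = b ` I n" for n
  ultimately have \<B>n_card: "|\<B>n n| <o q" for n
    using card_of_image ordLeq_ordLess_trans unfolding \<B>n_def by metis
  have I_sub: "I n \<subseteq> Field q" for n unfolding I_def underS_def Field_def by blast
  have \<B>n_sub: "\<B>n n \<subseteq> \<B>" for n
    using b I_sub[of n] unfolding \<B>n_def bij_betw_def by blast
  have \<B>n_mono: "\<B>n m \<subseteq> \<B>n n" if "m \<le> n" for m n
    using that unfolding \<B>n_def I_def by (intro image_mono UN_mono) auto
  have \<B>n_cover: "\<exists>n. B \<in> \<B>n n" if B: "B \<in> \<B>" for B
  proof -
    obtain i where i: "i \<in> Field q" "B = b i" using B b unfolding bij_betw_def by blast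
    obtain a where "a \<in> K" "i \<noteq> a" "(i, a) \<in> q"
      using K(2) i(1) unfolding cofinal_def q_def by blast
    then obtain n where "i \<noteq> k n" "(i, k n) \<in> q" using k by blast
    then have "i \<in> I n" unfolding I_def underS_def by auto
    then show ?thesis using i(2) unfolding \<B>n_def by blast
  qed
  note UD = uniform_ultrafilterD[OF U]
  have \<B>U: "\<B> \<subseteq> U" using \<B> unfolding is_base_def by blast
  have \<B>\<kappa>: "B \<subseteq> \<kappa>" if "B \<in> \<B>" for B using that \<B>U UD(1) kappa_subsetsD(1) by blast
  have "\<exists>S\<in>U. \<forall>B\<in>\<B>n n. |B - S| =o r" for n
  proof -
    have "\<B>n n \<subseteq> kappa_subsets r" using \<B>n_sub \<B>U UD(1) by blast
    then obtain S where S: "S \<subseteq> \<kappa>" "\<And>B. B \<in> \<B>n n \<Longrightarrow> splits r S B"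
      using split_small_family \<B>n_card unfolding q_def by metis
    \<comment> \<open>Replacing a splitting set by its complement preserves splitting, so it may be
      taken in \<open>U\<close>. Only the half saying that \<open>B - S\<close> is large is
      kept.\<close>
    have "S \<in> U \<or> \<kappa> - S \<in> U" using UD(4) S(1) by blast
    moreover have "|B - S| =o r" "|B - (\<kappa> - S)| =o r" if "B \<in> \<B>n n" for B
    proof -
      have "B - (\<kappa> - S) = S \<inter> B" using \<B>\<kappa> \<B>n_sub that by blast
      then show "|B - S| =o r" "|B - (\<kappa> - S)| =o r" using S(2)[OF that] by (simp_all add: splits_def)
    qed
    ultimately show ?thesis by blast
  qed
  then obtain S where S: "\<And>n. S n \<in> U" "\<And>n B. B \<in> \<B>n n \<Longrightarrow> |B - S n| =o r" by metis
  \<comment> \<open>The index range is strict, so \<open>D 0\<close> is \<kappa>. The differences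
    \<open>P n\<close> below are disjoint and cover everything outside the intersection of all
    \<open>D n\<close>.\<close>
  define D where "D n = \<kappa> \<inter> (\<Inter>m<n. S m)" for n
  have D_Suc: "D (Suc n) = D n \<inter> S n" for n unfolding D_def by (auto simp: lessThan_Suc)
  have D_anti: "D n \<subseteq> D m" if "m \<le> n" for m n using that unfolding D_def by force
  have D_U: "D n \<in> U" for n
  proof (induction n)
    case 0 then show ?case using UD(5) by (simp add: D_def)
  next
    case (Suc n) then show ?case using UD(3) S(1) by (simp add: D_Suc)
  qed
  define P where "P n = D n - D (Suc n)" for n
  have P_disj: "i = j" if "x \<in> P i" "x \<in> P j" for i j x
    using that D_anti[of "Suc i" j] D_anti[of "Suc j" i] unfolding P_def
    by (metis Diff_iff Suc_leI linorder_neqE_nat subsetD)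
  have P_cover: "\<exists>i\<in>{m..<n}. x \<in> P i" if "x \<in> D m" "x \<notin> D n" for x m n
    using that(2)
  proof (induction n)
    case 0 then show ?case using that(1) by (simp add: D_def)
  next
    case (Suc n)
    show ?case
    proof (cases "x \<in> D n")
      case True
      then have "x \<in> P n" using Suc.prems by (simp add: P_def)
      moreover have "m \<le> n" using D_anti[of "Suc n" m] that(1) Suc.prems by (meson not_less_eq_eq subsetD)
      ultimately show ?thesis by auto
    next
      case False then show ?thesis using Suc.IH by force
    qed
  qed
  \<comment> \<open>A base element inside \<open>X\<close> appears in some \<open>\<B>n n\<close>,
    and it already leaves \<kappa> many points outside \<open>S n\<close>.\<close>
  have not_pseudo: "\<exists>n. \<not> |X - D n| <o r" if X: "X \<in> U" for X
  proof -
    obtain B where B: "B \<in> \<B>" "B \<subseteq> X" using \<B> X unfolding is_base_def by blast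
    then obtain n where n: "B \<in> \<B>n n" using \<B>n_cover by blast
    have "B - S n \<subseteq> X - D (Suc n)" using B(2) D_Suc by blast
    then have "\<not> |X - D (Suc n)| <o r"
      using S(2)[OF n] small_mono not_ordLess_ordIso by blast
    then show ?thesis by blast
  qed
  \<comment> \<open>The set \<open>X \<inter> D m\<close> is in \<open>U\<close>, so it has \<kappa>
    many points outside some \<open>D n\<close>. These lie in the finitely many pieces from
    \<open>m\<close> up to \<open>n\<close>, so one trace is large.\<close>
  have large_piece: "\<exists>i\<ge>m. \<not> |X \<inter> P i| <o r" if "X \<in> U" for X m
  proof (rule ccontr)
    assume neg: "\<not> ?thesis"
    have "X \<inter> D m \<in> U" using UD(3) that D_U by blast
    then obtain n where n: "\<not> |X \<inter> D m - D n| <o r" using not_pseudo by blast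
    have "|\<Union>i\<in>{m..<n}. X \<inter> P i| <o r"
    proof -
      have "|\<Union>i\<in>A. X \<inter> P i| <o r" if "finite A" "A \<subseteq> {m..}" for A
        using that
      proof (induction A)
        case empty then show ?case by (simp add: small_finite)
      next
        case (insert i A)
        then have "|X \<inter> P i| <o r" using neg by auto
        moreover have "|\<Union>i\<in>A. X \<inter> P i| <o r" using insert by simp
        ultimately show ?case by (simp add: small_Un)
      qed
      then show ?thesis by force
    qed
    moreover have "X \<inter> D m - D n \<subseteq> (\<Union>i\<in>{m..<n}. X \<inter> P i)" using P_cover[of _ m n] by blast
    ultimately show False using n small_mono by blast
  qed
  have "\<exists>T\<subseteq>\<kappa>. \<forall>B\<in>\<B>n n. \<not> |B \<inter> P n| <o r \<longrightarrow> splits r T (B \<inter> P n)" for n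
  proof -
    \<comment> \<open>Only the large traces are kept, as a small set cannot be split; there are
      still fewer of them than the reaping number.\<close>
    define \<G> where "\<G> = (\<lambda>B. B \<inter> P n) ` {B \<in> \<B>n n. \<not> |B \<inter> P n| <o r}"
    have "\<G> \<subseteq> kappa_subsets r"
      unfolding \<G>_def using \<B>\<kappa> \<B>n_sub[of n] by (auto intro!: kappa_subsetsI)
    moreover have "|\<G>| \<le>o |\<B>n n|"
      unfolding \<G>_def using card_of_image card_of_mono1 ordLeq_transitive
      by (metis (no_types, lifting) mem_Collect_eq subsetI)
    then have "|\<G>| <o reaping_number r"
      using \<B>n_card[of n] ordLeq_ordLess_trans unfolding q_def by blast
    ultimately obtain T where "T \<subseteq> \<kappa>" "\<And>B. B \<in> \<G> \<Longrightarrow> splits r T B"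
      using split_small_family by metis
    then show ?thesis unfolding \<G>_def by blast
  qed
  then obtain T where T: "\<And>n. T n \<subseteq> \<kappa>"
    "\<And>n B. B \<in> \<B>n n \<Longrightarrow> \<not> |B \<inter> P n| <o r \<Longrightarrow> splits r (T n) (B \<inter> P n)"
    by metis
  \<comment> \<open>Disjointness of the pieces makes \<open>R\<close> agree with \<open>T n\<close>
    on each \<open>P n\<close>.\<close>
  define R where "R = (\<Union>n. P n \<inter> T n)"
  have "R \<subseteq> \<kappa>" using T(1) unfolding R_def by blast
  then have "R \<in> U \<or> \<kappa> - R \<in> U" using UD(4) by blast
  then obtain B where B: "B \<in> \<B>" "B \<subseteq> R \<or> B \<subseteq> \<kappa> - R" using \<B> unfolding is_base_def by blast
  obtain m where m: "B \<in> \<B>n m" using \<B>n_cover B(1) by blast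
  \<comment> \<open>Asking for \<open>m \<le> i\<close> puts \<open>B\<close> into
    \<open>\<B>n i\<close>, so \<open>T i\<close> was chosen to split its trace on
    \<open>P i\<close>.\<close>
  obtain i where i: "m \<le> i" "\<not> |B \<inter> P i| <o r" using large_piece B(1) \<B>U by blast
  have "splits r (T i) (B \<inter> P i)" using T(2) \<B>n_mono[OF i(1)] m i(2) by blast
  then obtain x y where x: "x \<in> T i" "x \<in> B" "x \<in> P i" and y: "y \<notin> T i" "y \<in> B" "y \<in> P i"
    using splits_nonempty by blast
  have "x \<in> R" using x unfolding R_def by blast
  moreover have "y \<notin> R"
  proof
    assume "y \<in> R"
    then obtain j where "y \<in> P j" "y \<in> T j" unfolding R_def by blast
    then show False using P_disj[OF y(3), of j] y(1) by simp
  qed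
  ultimately show False using B(2) x(2) y(2) by blast
qed

end

section \<open>Equality with the ultrafilter number, and the cofinality statement\<close>

theorem theorem2p10:
  fixes r :: "'a rel"
  assumes "Card_order r" and "\<not> finite (Field r)" and "regularCard r"
    and "reaping_number r <o dominating_number r"
  shows "reaping_number r =o ultrafilter_number r \<and>
         (\<forall>K. K \<subseteq> Field (reaping_number r) \<and> cofinal K (reaping_number r)
              \<longrightarrow> natLeq <o card_of K)"
proof -
  interpret regular_cardinal r using assms by unfold_locales
  obtain M where M: "unsplit_family r M" "reaping_number r = |M|" "\<And>B. unsplit_family r B \<Longrightarrow> |M| \<le>o |B|"
    using mincard_attained[of "unsplit_family r", OF kappa_subsets_unsplit]
    unfolding reaping_number_def by metis
  obtain \<F> where \<F>: "\<F> \<subseteq> kappa_subsets r" "infinite \<F>" "|\<F>| \<le>o |M|"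
    "\<And>A S. A \<in> \<F> \<Longrightarrow> \<exists>B\<in>\<F>. B \<subseteq> A \<and> (B \<subseteq> S \<or> B \<inter> S = {})"
    using hereditary_unsplit[OF M(1)] by metis
  have "|\<F>| <o dominating_number r"
    using \<F>(3) assms(4) ordLeq_ordLess_trans unfolding M(2) by blast
  then obtain \<C> where \<C>: "uniform_ultrafilter_base r \<C>" "|\<C>| \<le>o |\<F>|"
    using small_ultrafilter_base[OF \<F>(1,2,4)] by metis
  obtain \<B> where \<B>: "uniform_ultrafilter_base r \<B>" "ultrafilter_number r = |\<B>|"
      "\<And>B. uniform_ultrafilter_base r B \<Longrightarrow> |\<B>| \<le>o |B|"
    using mincard_attained[of "uniform_ultrafilter_base r", OF \<C>(1)]
    unfolding ultrafilter_number_def by metis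
  \<comment> \<open>Minimality of \<open>\<B>\<close> closes the cycle: \<open>|\<B>|\<close> is at
    most \<open>|\<C>|\<close>, then \<open>|\<F>|\<close>, then \<open>|M|\<close>, while
    \<open>base_unsplit\<close> gives the converse inequality.\<close>
  have "|\<B>| \<le>o |M|" using \<B>(3)[OF \<C>(1)] \<C>(2) \<F>(3) ordLeq_transitive by blast
  then have eq: "|M| =o |\<B>|" using M(3)[OF base_unsplit[OF \<B>(1)]] ordIso_iff_ordLeq by blast
  obtain U where U: "uniform_ultrafilter r U" "is_base U \<B>"
    using \<B>(1) unfolding uniform_ultrafilter_base_def by blast
  have "|\<B>| =o reaping_number r" using eq ordIso_symmetric unfolding M(2) by blast
  then show ?thesis
    using eq uncountable_cofinality[OF U] unfolding M(2) \<B>(2) by blast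
qed

end
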